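(* Let $f_1=\sin\theta\cos\phi$, $f_2=\sin\theta\sin\phi$, $f_3=\cos\theta$, let $\mathcal{S}_1=\{Xf_1+Yf_2+Zf_3 : (X,Y,Z)\in\mathbb{R}^3\}$, and identify $F=Xf_1+Yf_2+Zf_3$ with the vector $(X,Y,Z)\in\mathbb{R}^3$. Let $$\{F,F'\}=\frac{1}{\sin\theta}\left(\frac{\partial F}{\partial\theta}\frac{\partial F'}{\partial\phi}-\frac{\partial F}{\partial\phi}\frac{\partial F'}{\partial\theta}\right)$$ be the Poisson bracket associated with the standard symplectic form on the unit sphere. Then for any two functions $F,F'\in\mathcal{S}_1$ one has $\{F,F'\}=F\wedge F'$ (in particular $\{F,F'\}\in\mathcal{S}_1$), where $\wedge$ is the standard vector product on $\mathbb{R}^3$.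
   Context: The standard vector product is $(x,y,z)\wedge(x',y',z')=(yz'-zy',\,zx'-xz',\,xy'-yx')$. The coordinates $(\theta,\phi)$ on the unit sphere are given by $x=\sin\theta\cos\phi$, $y=\sin\theta\sin\phi$, $z=\cos\theta$. *)

theory Defs
  imports "HOL-Analysis.Analysis"
begin

text \<open>
  Functions on the unit sphere are written in the coordinates \<open>(\<theta>, \<phi>)\<close>, as extensional
  functions on the domain below. The poles (\<open>sin \<theta> = 0\<close>), where the coordinate formula for the
  Poisson bracket is meaningless, are excluded; \<open>\<phi>\<close> is not confined to one period.
\<close>

definition sphere_coords :: "(real \<times> real) set" where
  "sphere_coords = {0<..<pi} \<times> UNIV"

definition f1 :: "real \<times> real \<Rightarrow> real" where
  "f1 = (\<lambda>(\<theta>, \<phi>)\<in>sphere_coords. sin \<theta> * cos \<phi>)"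

definition f2 :: "real \<times> real \<Rightarrow> real" where
  "f2 = (\<lambda>(\<theta>, \<phi>)\<in>sphere_coords. sin \<theta> * sin \<phi>)"

definition f3 :: "real \<times> real \<Rightarrow> real" where
  "f3 = (\<lambda>(\<theta>, \<phi>)\<in>sphere_coords. cos \<theta>)"

definition S1_of_vec :: "real ^ 3 \<Rightarrow> real \<times> real \<Rightarrow> real" where
  "S1_of_vec v = (\<lambda>p\<in>sphere_coords. v $ 1 * f1 p + v $ 2 * f2 p + v $ 3 * f3 p)"

definition S1 :: "(real \<times> real \<Rightarrow> real) set" where
  "S1 = range S1_of_vec"

definition vec_of_S1 :: "(real \<times> real \<Rightarrow> real) \<Rightarrow> real ^ 3" where
  "vec_of_S1 = inv S1_of_vec"

lemma inj_S1_of_vec: "inj S1_of_vec"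
proof (rule injI)
  fix v w :: "real ^ 3"
  assume eq: "S1_of_vec v = S1_of_vec w"
  have *: "v $ 1 * (sin \<theta> * cos \<phi>) + v $ 2 * (sin \<theta> * sin \<phi>) + v $ 3 * cos \<theta>
         = w $ 1 * (sin \<theta> * cos \<phi>) + w $ 2 * (sin \<theta> * sin \<phi>) + w $ 3 * cos \<theta>"
    if "0 < \<theta>" "\<theta> < pi" for \<theta> \<phi>
    using fun_cong[OF eq, of "(\<theta>, \<phi>)"] that
    by (simp add: S1_of_vec_def f1_def f2_def f3_def sphere_coords_def)
  have 1: "v $ 1 = w $ 1" using *[of "pi/2" 0] by simp
  have 2: "v $ 2 = w $ 2" using *[of "pi/2" "pi/2"] by simp
  have 3: "v $ 3 = w $ 3" using *[of "pi/4" 0] 1 by (simp add: cos_45)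
  from 1 2 3 show "v = w" by (simp add: vec_eq_iff forall_3)
qed

lemma vec_of_S1_of_vec: "vec_of_S1 (S1_of_vec v) = v"
  unfolding vec_of_S1_def by (rule inv_f_f[OF inj_S1_of_vec])

definition S1_wedge ::
  "(real \<times> real \<Rightarrow> real) \<Rightarrow> (real \<times> real \<Rightarrow> real) \<Rightarrow> real \<times> real \<Rightarrow> real" where
  "S1_wedge F G = S1_of_vec (cross3 (vec_of_S1 F) (vec_of_S1 G))"

definition d_theta :: "(real \<times> real \<Rightarrow> real) \<Rightarrow> real \<Rightarrow> real \<Rightarrow> real" where
  "d_theta F \<theta> \<phi> = deriv (\<lambda>t. F (t, \<phi>)) \<theta>"

definition d_phi :: "(real \<times> real \<Rightarrow> real) \<Rightarrow> real \<Rightarrow> real \<Rightarrow> real" where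
  "d_phi F \<theta> \<phi> = deriv (\<lambda>t. F (\<theta>, t)) \<phi>"

definition poisson_bracket ::
  "(real \<times> real \<Rightarrow> real) \<Rightarrow> (real \<times> real \<Rightarrow> real) \<Rightarrow> real \<times> real \<Rightarrow> real" where
  "poisson_bracket F G = (\<lambda>(\<theta>, \<phi>)\<in>sphere_coords.
     1 / sin \<theta> * (d_theta F \<theta> \<phi> * d_phi G \<theta> \<phi> - d_phi F \<theta> \<phi> * d_theta G \<theta> \<phi>))"

end

theory Submission
  imports Defs
begin

text \<open>
  Off the poles the coordinate derivatives of \<open>F = X f\<^sub>1 + Y f\<^sub>2 + Z f\<^sub>3\<close> are
  \<open>F\<^sub>\<theta> = cos \<theta> (X cos \<phi> + Y sin \<phi>) - Z sin \<theta>\<close> and \<open>F\<^sub>\<phi> = sin \<theta> (Y cos \<phi> - X sin \<phi>)\<close>. The factor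
  \<open>sin \<theta>\<close> of \<open>F\<^sub>\<phi>\<close> is what cancels the singular weight \<open>1 / sin \<theta>\<close> of the bracket, leaving
  \<open>F\<^sub>\<theta> (Y' cos \<phi> - X' sin \<phi>) - (Y cos \<phi> - X sin \<phi>) F'\<^sub>\<theta>\<close>.

  Geometrically, \<open>F\<^sub>\<theta>\<close> and \<open>F\<^sub>\<phi> / sin \<theta>\<close> are the inner products of \<open>(X, Y, Z)\<close> with the unit tangent
  vectors \<open>e\<^sub>\<theta>\<close> and \<open>e\<^sub>\<phi>\<close> of the sphere at the point \<open>n = (f\<^sub>1, f\<^sub>2, f\<^sub>3)\<close>. Since \<open>e\<^sub>\<theta>\<close>, \<open>e\<^sub>\<phi>\<close>, \<open>n\<close> is a
  positively oriented orthonormal frame, the difference of products above is the inner product of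
  \<open>(X, Y, Z) \<and> (X', Y', Z')\<close> with \<open>n = e\<^sub>\<theta> \<and> e\<^sub>\<phi>\<close>, that is, the function identified with the vector
  product. In coordinates this is a polynomial identity modulo \<open>sin\<^sup>2 \<phi> + cos\<^sup>2 \<phi> = 1\<close>.
\<close>

lemma S1_of_vec_apply:
  assumes "0 < \<theta>" "\<theta> < pi"
  shows "S1_of_vec v (\<theta>, \<phi>) =
    v $ 1 * (sin \<theta> * cos \<phi>) + v $ 2 * (sin \<theta> * sin \<phi>) + v $ 3 * cos \<theta>"
  using assms by (simp add: S1_of_vec_def f1_def f2_def f3_def sphere_coords_def)

lemma d_theta_S1_of_vec:
  assumes "0 < \<theta>" "\<theta> < pi"
  shows "d_theta (S1_of_vec v) \<theta> \<phi> =
    cos \<theta> * (v $ 1 * cos \<phi> + v $ 2 * sin \<phi>) - v $ 3 * sin \<theta>"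
proof -
  let ?g = "\<lambda>t. v $ 1 * (sin t * cos \<phi>) + v $ 2 * (sin t * sin \<phi>) + v $ 3 * cos t"
  have "(?g has_real_derivative
      cos \<theta> * (v $ 1 * cos \<phi> + v $ 2 * sin \<phi>) - v $ 3 * sin \<theta>) (at \<theta>)"
    by (auto intro!: derivative_eq_intros simp: algebra_simps)
  (* The closed formula is only valid on the coordinate domain, but that is a neighbourhood of \<theta>. *)
  then have "((\<lambda>t. S1_of_vec v (t, \<phi>)) has_real_derivative
      cos \<theta> * (v $ 1 * cos \<phi> + v $ 2 * sin \<phi>) - v $ 3 * sin \<theta>) (at \<theta>)"
    by (rule has_field_derivative_transform_within_open[where S = "{0<..<pi}"])
      (use assms in \<open>auto simp: S1_of_vec_apply\<close>)
  then show ?thesis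
    unfolding d_theta_def by (rule DERIV_imp_deriv)
qed

lemma d_phi_S1_of_vec:
  assumes "0 < \<theta>" "\<theta> < pi"
  shows "d_phi (S1_of_vec v) \<theta> \<phi> = sin \<theta> * (v $ 2 * cos \<phi> - v $ 1 * sin \<phi>)"
  unfolding d_phi_def S1_of_vec_apply[OF assms]
  by (rule DERIV_imp_deriv) (auto intro!: derivative_eq_intros simp: algebra_simps)

text \<open>
  The triple product identity \<open>(v \<bullet> e\<^sub>\<theta>) (w \<bullet> e\<^sub>\<phi>) - (v \<bullet> e\<^sub>\<phi>) (w \<bullet> e\<^sub>\<theta>) = (v \<and> w) \<bullet> n\<close>, written out for
  the spherical frame; the factor \<open>sin \<theta>\<close> of \<open>F\<^sub>\<phi>\<close> has been divided out.
\<close>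

lemma cross3_spherical_frame:
  fixes v w :: "real ^ 3"
  shows "(cos \<theta> * (v $ 1 * cos \<phi> + v $ 2 * sin \<phi>) - v $ 3 * sin \<theta>) * (w $ 2 * cos \<phi> - w $ 1 * sin \<phi>)
       - (v $ 2 * cos \<phi> - v $ 1 * sin \<phi>) * (cos \<theta> * (w $ 1 * cos \<phi> + w $ 2 * sin \<phi>) - w $ 3 * sin \<theta>)
       = cross3 v w $ 1 * (sin \<theta> * cos \<phi>) + cross3 v w $ 2 * (sin \<theta> * sin \<phi>)
         + cross3 v w $ 3 * cos \<theta>"
proof -
  have "(sin \<phi>)\<^sup>2 + (cos \<phi>)\<^sup>2 = 1"
    by simp
  then show ?thesis
    unfolding cross3_def vector_3 by algebra
qed

lemma poisson_bracket_S1_of_vec: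
  "poisson_bracket (S1_of_vec v) (S1_of_vec w) = S1_of_vec (cross3 v w)"
proof (rule ext)
  fix p :: "real \<times> real"
  obtain \<theta> \<phi> where p: "p = (\<theta>, \<phi>)"
    by (cases p)
  show "poisson_bracket (S1_of_vec v) (S1_of_vec w) p = S1_of_vec (cross3 v w) p"
  proof (cases "p \<in> sphere_coords")
    case True
    then have \<theta>: "0 < \<theta>" "\<theta> < pi"
      by (auto simp: p sphere_coords_def)
    then have "sin \<theta> \<noteq> 0"
      using sin_gt_zero by force
    then have cancel: "1 / sin \<theta> * (a * (sin \<theta> * b) - sin \<theta> * c * d) = a * b - c * d" for a b c d
      by (simp add: field_simps)
    show ?thesis
      using True
      by (simp add: p poisson_bracket_def d_theta_S1_of_vec[OF \<theta>] d_phi_S1_of_vec[OF \<theta>]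
          S1_of_vec_apply[OF \<theta>] cancel cross3_spherical_frame del: times_divide_eq_left)
  next
    (* Outside the domain both sides are undefined by extensionality. *)
    case False
    then show ?thesis
      by (simp add: poisson_bracket_def S1_of_vec_def)
  qed
qed

theorem proposition1p2:
  fixes F F' :: "real \<times> real \<Rightarrow> real"
  assumes "F \<in> S1" and "F' \<in> S1"
  shows "poisson_bracket F F' = S1_wedge F F' \<and> poisson_bracket F F' \<in> S1"
proof -
  obtain v w where "F = S1_of_vec v" "F' = S1_of_vec w"
    using assms by (auto simp: S1_def)
  then show ?thesis
    by (simp add: poisson_bracket_S1_of_vec S1_wedge_def vec_of_S1_of_vec S1_def)
qed

end
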